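(* Let $\Gamma$ be a partial order with maximum chain length $n$. Then $\Gamma(\mathbb{T})$ satisfies exactly the same semigroup identities as $UT_n(\mathbb{T})$.
   Context: The tropical semiring $\mathbb{T}$ is the set $\mathbb{R}\cup\{-\infty\}$ with operations $a\oplus b=\max(a,b)$ and $a\otimes b=a+b$, where $-\infty\oplus a=a$ and $-\infty\otimes a=-\infty$. $\bigoplus$ over a bounded-above set denotes its supremum. $\Gamma$ is a (not necessarily finite) partially ordered set; that it has maximum chain length $n$ means that there exists a sequence $v_1\le\cdots\le v_k$ of $k$ distinct elements of $\Gamma$ if and only if $k\le n$. $\Gamma(\mathbb{T})$ is the semigroup of all functions $A:\Gamma\times\Gamma\to\mathbb{T}$, written $(i,j)\mapsto A_{i,j}$, that are bounded above (the set of all entries has an upper bound in $\mathbb{T}$) and satisfy $A_{i,j}\ne-\infty\Rightarrow i\le j$, with multiplication $(M\otimes N)_{i,j}=\bigoplus_{k\in\Gamma}M_{i,k}\otimes N_{k,j}$. $UT_n(\mathbb{T})$ is the monoid of all $n\times n$ matrices over $\mathbb{T}$ with all entries below the main diagonal equal to $-\infty$, under tropical matrix multiplication. A semigroup identity is a pair of words $u=v$ in the free semigroup $\Sigma^+$ on a finite alphabet $\Sigma$; it is satisfied by a semigroup $S$ if every semigroup morphism $\Sigma^+\to S$ maps $u$ and $v$ to the same element of $S$. *)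

theory Defs
  imports "HOL-Library.Extended_Real" "Jordan_Normal_Form.Matrix"
begin

text \<open>
  The tropical semiring: \<open>+\<close> is the maximum, \<open>*\<close> is the addition of \<open>ereal\<close>, so that
  \<open>0\<close> denotes minus infinity and \<open>1\<close> denotes the real number zero.
\<close>

typedef tropical = "{x::ereal. x \<noteq> \<infinity>}"
  by (rule exI[of _ 0]) simp

setup_lifting type_definition_tropical

instantiation tropical :: comm_semiring_1
begin

lift_definition zero_tropical :: tropical is "-\<infinity>" by simp
lift_definition one_tropical :: tropical is 0 by simp
lift_definition plus_tropical :: "tropical \<Rightarrow> tropical \<Rightarrow> tropical" is max
  by (simp add: max_def)
lift_definition times_tropical :: "tropical \<Rightarrow> tropical \<Rightarrow> tropical" is "(+)"
  by simp

instance
proof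
  fix a b c :: tropical
  show "a + b + c = a + (b + c)" by transfer (simp add: max.assoc)
  show "a + b = b + a" by transfer (simp add: max.commute)
  show "0 + a = a" by transfer simp
  show "a * b * c = a * (b * c)" by transfer (simp add: add.assoc)
  show "a * b = b * a" by transfer (simp add: add.commute)
  show "1 * a = a" by transfer simp
  show "0 * a = 0" by transfer simp
  show "a * 0 = 0" by transfer simp
  show "(0::tropical) \<noteq> 1" by transfer simp
  show "(a + b) * c = a * c + b * c"
    by transfer (simp add: max_def, metis add_right_mono antisym linear)
qed

end

instantiation tropical :: linorder
begin

lift_definition less_eq_tropical :: "tropical \<Rightarrow> tropical \<Rightarrow> bool" is "(\<le>)" .
lift_definition less_tropical :: "tropical \<Rightarrow> tropical \<Rightarrow> bool" is "(<)" .

instance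
proof
  fix x y z :: tropical
  show "x < y \<longleftrightarrow> x \<le> y \<and> \<not> y \<le> x" by transfer auto
  show "x \<le> x" by transfer simp
  show "x \<le> y \<Longrightarrow> y \<le> z \<Longrightarrow> x \<le> z" by transfer (rule order_trans)
  show "x \<le> y \<Longrightarrow> y \<le> x \<Longrightarrow> x = y" by transfer (rule antisym)
  show "x \<le> y \<or> y \<le> x" by transfer (rule linear)
qed

end

lemma plus_tropical_eq_max: "a + b = max a (b::tropical)"
  unfolding max_def by transfer (simp add: max_def)

text \<open>
  As \<open>tropical\<close> has no greatest element, suprema are meaningful for bounded-above sets only.
  The supremum of the empty set is \<open>0\<close>, that is, minus infinity.
\<close>

instantiation tropical :: conditionally_complete_linorder
begin

definition inf_tropical :: "tropical \<Rightarrow> tropical \<Rightarrow> tropical" where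
  "inf_tropical = min"

definition sup_tropical :: "tropical \<Rightarrow> tropical \<Rightarrow> tropical" where
  "sup_tropical = max"

definition Sup_tropical :: "tropical set \<Rightarrow> tropical" where
  "Sup_tropical X = Abs_tropical (Sup (Rep_tropical ` X))"

definition Inf_tropical :: "tropical set \<Rightarrow> tropical" where
  "Inf_tropical X = Abs_tropical (Inf (Rep_tropical ` X))"

instance
proof
  fix x y z :: tropical and X :: "tropical set"
  show "inf x y \<le> x" "inf x y \<le> y" "x \<le> sup x y" "y \<le> sup x y"
    by (simp_all add: inf_tropical_def sup_tropical_def)
  show "x \<le> y \<Longrightarrow> x \<le> z \<Longrightarrow> x \<le> inf y z" by (simp add: inf_tropical_def)
  show "y \<le> x \<Longrightarrow> z \<le> x \<Longrightarrow> sup y z \<le> x" by (simp add: sup_tropical_def)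
  have Inf: "Rep_tropical (Inf X) = Inf (Rep_tropical ` X)" if "X \<noteq> {}" for X
  proof -
    from that obtain a where "a \<in> X" by auto
    then have "Inf (Rep_tropical ` X) \<le> Rep_tropical a" by (auto intro: Inf_lower)
    then have "Inf (Rep_tropical ` X) \<noteq> \<infinity>" using Rep_tropical[of a] by auto
    then show ?thesis unfolding Inf_tropical_def by (subst Abs_tropical_inverse) auto
  qed
  have Sup: "Rep_tropical (Sup X) = Sup (Rep_tropical ` X)" if "\<And>x. x \<in> X \<Longrightarrow> x \<le> b" for X b
  proof -
    have "Sup (Rep_tropical ` X) \<le> Rep_tropical b"
      using that by (auto intro!: Sup_least simp: less_eq_tropical.rep_eq)
    then have "Sup (Rep_tropical ` X) \<noteq> \<infinity>" using Rep_tropical[of b] by auto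
    then show ?thesis unfolding Sup_tropical_def by (subst Abs_tropical_inverse) auto
  qed
  show "Inf X \<le> x" if "x \<in> X"
    using that by (subst less_eq_tropical.rep_eq, subst Inf) (auto intro: Inf_lower)
  show "z \<le> Inf X" if "X \<noteq> {}" "\<And>x. x \<in> X \<Longrightarrow> z \<le> x"
    using that Inf[of X] by (auto simp: less_eq_tropical.rep_eq intro!: Inf_greatest)
  show "x \<le> Sup X" if "x \<in> X" "bdd_above X"
    using that by (metis Sup Sup_upper bdd_above.unfold imageI less_eq_tropical.rep_eq)
  show "Sup X \<le> z" if "X \<noteq> {}" "\<And>x. x \<in> X \<Longrightarrow> x \<le> z"
    using that Sup[of X z] by (auto simp: less_eq_tropical.rep_eq intro!: Sup_least)
qed

end

lemma Sup_tropical_empty: "Sup {} = (0::tropical)"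
  by (simp add: Sup_tropical_def zero_tropical_def bot_ereal_def)

text \<open>
  A partially ordered set is a carrier \<open>G\<close> with an order relation \<open>r\<close>. Chains may be empty,
  so the empty poset has maximum chain length \<open>0\<close>.
\<close>

definition max_chain_length :: "'a set \<Rightarrow> 'a rel \<Rightarrow> nat \<Rightarrow> bool" where
  "max_chain_length G r n \<longleftrightarrow>
    (\<forall>k. (\<exists>vs. length vs = k \<and> distinct vs \<and> set vs \<subseteq> G \<and> successively (\<lambda>x y. (x, y) \<in> r) vs)
         \<longleftrightarrow> k \<le> n)"

text \<open>
  The semigroup of bounded-above functions on \<open>G \<times> G\<close> supported on \<open>r\<close>. A function on
  \<open>G \<times> G\<close> is represented by its extension by \<open>0\<close> (minus infinity) to the whole type; this
  representation is unique, because \<open>partial_order_on G r\<close> includes \<open>r \<subseteq> G \<times> G\<close>.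
\<close>

definition poset_matrices :: "'a set \<Rightarrow> 'a rel \<Rightarrow> ('a \<Rightarrow> 'a \<Rightarrow> tropical) monoid" where
  "poset_matrices G r =
    \<lparr>carrier = {A. bdd_above {A i j | i j. i \<in> G \<and> j \<in> G} \<and> (\<forall>i j. A i j \<noteq> 0 \<longrightarrow> (i, j) \<in> r)},
     monoid.mult = (\<lambda>M N i j. SUP k\<in>G. M i k * N k j),
     one = (\<lambda>i j. if i \<in> G \<and> i = j then 1 else 0)\<rparr>"

definition UT :: "nat \<Rightarrow> tropical mat monoid" where
  "UT n = \<lparr>carrier = {A \<in> carrier_mat n n. upper_triangular A}, monoid.mult = (*), one = 1\<^sub>m n\<rparr>"

text \<open>
  The free semigroup of nonempty words. Only the fields \<open>carrier\<close> and \<open>mult\<close> matter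
  for \<open>hom\<close>, whose elements are therefore the semigroup morphisms; the \<open>one\<close> field is a
  dummy lying outside the carrier.
\<close>

definition free_semigroup :: "'x set \<Rightarrow> 'x list monoid" where
  "free_semigroup X = \<lparr>carrier = lists X - {[]}, monoid.mult = (@), one = []\<rparr>"

definition satisfies_identity ::
  "('s, 'b) monoid_scheme \<Rightarrow> 'x set \<Rightarrow> 'x list \<Rightarrow> 'x list \<Rightarrow> bool" where
  "satisfies_identity S X u v \<longleftrightarrow> (\<forall>\<phi> \<in> hom (free_semigroup X) S. \<phi> u = \<phi> v)"

end

theory Submission
  imports Defs
begin

text \<open>
  An entry of a product of matrices is the supremum of the weights of the corresponding paths.
  A path of nonzero weight in a poset of maximum chain length \<open>n\<close> runs along a chain with at
  most \<open>n\<close> elements, so its weight is already seen by the matrices cut down to that chain,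
  which are upper triangular of size at most \<open>n\<close>. Hence identities of \<open>UT n\<close> transfer to the
  poset. Conversely, a chain with \<open>n\<close> elements embeds \<open>UT n\<close> into the poset matrices.
\<close>

section \<open>Order, inverses and suprema in the tropical semiring\<close>

lemma tropical_zero_le [simp]: "0 \<le> (a::tropical)"
  by transfer simp

lemma tropical_le_zero_iff [simp]: "a \<le> 0 \<longleftrightarrow> a = (0::tropical)"
  by (metis antisym tropical_zero_le)

lemma tropical_mult_mono: "a \<le> b \<Longrightarrow> c \<le> d \<Longrightarrow> a * c \<le> b * (d::tropical)"
  by transfer (rule add_mono)

lemma tropical_right_inverse:
  assumes "a \<noteq> (0::tropical)"
  obtains a' where "a * a' = 1"
proof -
  have "\<exists>a'. a * a' = 1" using assms
  proof transfer
    fix a :: ereal assume "a \<noteq> \<infinity>" "a \<noteq> -\<infinity>"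
    then show "\<exists>a'\<in>{x. x \<noteq> \<infinity>}. a + a' = 0"
      by (intro bexI[of _ "-a"]) (cases a; simp)+
  qed
  then show ?thesis using that by blast
qed

text \<open>For empty \<open>X\<close> both sides hold: the supremum is then \<open>0\<close>, the
  least element.\<close>

lemma tropical_Sup_le_iff:
  fixes b :: tropical
  shows "bdd_above X \<Longrightarrow> Sup X \<le> b \<longleftrightarrow> (\<forall>x\<in>X. x \<le> b)"
  by (cases "X = {}") (simp_all add: Sup_tropical_empty cSup_le_iff)

lemma tropical_sum_le_iff:
  fixes f :: "'i \<Rightarrow> tropical"
  shows "finite S \<Longrightarrow> sum f S \<le> b \<longleftrightarrow> (\<forall>k\<in>S. f k \<le> b)"
  by (induction S rule: finite_induct) (simp_all add: plus_tropical_eq_max)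

section \<open>Paths and their weights\<close>

text \<open>A path reading the letters of \<open>w\<close> has one vertex more than \<open>w\<close>
  has letters; the value \<open>1\<close> is the empty product that ends the recursion on such a
  path.\<close>

fun path_weight :: "('x \<Rightarrow> 'i \<Rightarrow> 'i \<Rightarrow> tropical) \<Rightarrow> 'x list \<Rightarrow> 'i list \<Rightarrow> tropical" where
  "path_weight A (x # w) (i # j # vs) = A x i j * path_weight A w (j # vs)"
| "path_weight A w vs = 1"

text \<open>Steps are not tied to an order, so the notion serves posets and index ranges alike; a
  step with entry \<open>0\<close> merely makes the weight \<open>0\<close>.\<close>

definition paths :: "'i set \<Rightarrow> nat \<Rightarrow> 'i \<Rightarrow> 'i \<Rightarrow> 'i list set" where
  "paths G m i j = {vs. length vs = Suc m \<and> set vs \<subseteq> G \<and> hd vs = i \<and> last vs = j}"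

lemma paths_Suc:
  "vs \<in> paths G (Suc m) i j \<longleftrightarrow>
    i \<in> G \<and> (\<exists>k\<in>G. \<exists>us. vs = i # k # us \<and> k # us \<in> paths G m k j)"
  by (cases vs; cases "tl vs") (auto simp: paths_def)

text \<open>Multiplication is monotone, so weights compare factor by factor. Both paths are images
  of one list \<open>ss\<close>, which lets paths pass between elements of the poset and positions
  in a chain.\<close>

lemma path_weight_mono:
  assumes "\<And>x s t. x \<in> set w \<Longrightarrow> s \<in> set ss \<Longrightarrow> t \<in> set ss \<Longrightarrow> B x (g s) (g t) \<le> A x (f s) (f t)"
  shows "path_weight B w (map g ss) \<le> path_weight A w (map f ss)"
  using assms
proof (induction w arbitrary: ss)
  case Nil
  show ?case by simp
next
  case (Cons x w)
  show ?case
  proof (cases "\<exists>s t us. ss = s # t # us")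
    case True
    then obtain s t us where ss: "ss = s # t # us" by blast
    have "path_weight B w (map g (t # us)) \<le> path_weight A w (map f (t # us))"
      by (rule Cons.IH) (use Cons.prems ss in auto)
    then show ?thesis using ss Cons.prems by (simp add: tropical_mult_mono)
  next
    case False
    then show ?thesis by (cases ss; cases "tl ss") auto
  qed
qed

text \<open>A product with a factor \<open>0\<close> is \<open>0\<close>, and the length condition
  makes every step of the path a factor.\<close>

lemma successively_if_path_weight_nonzero:
  assumes "path_weight A w vs \<noteq> 0" "length vs = Suc (length w)"
    and "\<And>x i j. x \<in> set w \<Longrightarrow> A x i j \<noteq> 0 \<Longrightarrow> R i j"
  shows "successively R vs"
  using assms by (induction A w vs rule: path_weight.induct)
    (auto simp: length_Suc_conv dest!: mult_not_zero)

text \<open>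
  The products in \<open>E\<close> are only specified by their upper bounds, which covers suprema over
  infinite posets and finite sums alike. Moving a factor across an inequality, which is
  possible since nonzero elements are invertible, replaces distributivity over suprema.
\<close>

lemma entry_le_iff_path_weights_le:
  fixes E :: "'x list \<Rightarrow> 'i \<Rightarrow> 'i \<Rightarrow> tropical"
  assumes single: "\<And>x i j. x \<in> X \<Longrightarrow> i \<in> G \<Longrightarrow> j \<in> G \<Longrightarrow> E [x] i j = A x i j"
    and step: "\<And>x w i j b. x \<in> X \<Longrightarrow> w \<in> lists X \<Longrightarrow> w \<noteq> [] \<Longrightarrow> i \<in> G \<Longrightarrow> j \<in> G \<Longrightarrow>
      E (x # w) i j \<le> b \<longleftrightarrow> (\<forall>k\<in>G. A x i k * E w k j \<le> b)"
    and "w \<in> lists X" "w \<noteq> []" "i \<in> G" "j \<in> G"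
  shows "E w i j \<le> b \<longleftrightarrow> (\<forall>vs\<in>paths G (length w) i j. path_weight A w vs \<le> b)"
  using assms(3-)
proof (induction w arbitrary: i b)
  case Nil
  then show ?case by simp
next
  case (Cons x w)
  show ?case
  proof (cases "w = []")
    \<comment> \<open>The free semigroup has no empty word, so the recursion bottoms out at single
      letters, with \<open>[i, j]\<close> as the only path.\<close>
    case True
    have "paths G (Suc 0) i j = {[i, j]}"
      using Cons.hyps Cons.prems by (auto simp: paths_def length_Suc_conv)
    moreover have "E [x] i j = A x i j" using single Cons.hyps Cons.prems by simp
    ultimately show ?thesis using True by simp
  next
    case False
    have weights: "A x i k * E w k j \<le> b \<longleftrightarrow>
        (\<forall>vs\<in>paths G (length w) k j. A x i k * path_weight A w vs \<le> b)" if "k \<in> G" for k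
    proof (cases "A x i k = 0")
      case True
      then show ?thesis by simp
    next
      case nonzero: False
      obtain a where a: "A x i k * a = 1"
        using tropical_right_inverse[OF nonzero] .
      have shift: "A x i k * c \<le> b \<longleftrightarrow> c \<le> a * b" for c
      proof
        assume "A x i k * c \<le> b"
        then have "a * (A x i k * c) \<le> a * b" by (intro tropical_mult_mono) auto
        moreover have "a * (A x i k * c) = c"
          using a by (metis mult.assoc mult.commute mult_1)
        ultimately show "c \<le> a * b" by simp
      next
        assume "c \<le> a * b"
        then have "A x i k * c \<le> A x i k * (a * b)" by (intro tropical_mult_mono) auto
        moreover have "A x i k * (a * b) = b"
          using a by (metis mult.assoc mult_1)
        ultimately show "A x i k * c \<le> b" by simp
      qed
      \<comment> \<open>The induction hypothesis is applied with the bound \<open>a * b\<close>,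
        which is why \<open>b\<close> is generalised.\<close>
      show ?thesis
        unfolding shift using Cons.IH[of k "a * b"] Cons.hyps Cons.prems False that by simp
    qed
    have "E (x # w) i j \<le> b \<longleftrightarrow> (\<forall>k\<in>G. A x i k * E w k j \<le> b)"
      using step Cons.hyps Cons.prems False by simp
    also have "\<dots> \<longleftrightarrow> (\<forall>k\<in>G. \<forall>vs\<in>paths G (length w) k j. A x i k * path_weight A w vs \<le> b)"
      using weights by simp
    also have "\<dots> \<longleftrightarrow> (\<forall>vs\<in>paths G (length (x # w)) i j. path_weight A (x # w) vs \<le> b)"
    proof (intro iffI ballI)
      fix vs
      assume *: "\<forall>k\<in>G. \<forall>vs\<in>paths G (length w) k j. A x i k * path_weight A w vs \<le> b"
        and "vs \<in> paths G (length (x # w)) i j"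
      then show "path_weight A (x # w) vs \<le> b" by (auto simp: paths_Suc)
    next
      fix k vs
      assume *: "\<forall>vs\<in>paths G (length (x # w)) i j. path_weight A (x # w) vs \<le> b"
        and k: "k \<in> G" and vs: "vs \<in> paths G (length w) k j"
      then obtain us where "vs = k # us"
        by (cases vs) (auto simp: paths_def)
      moreover have "i # vs \<in> paths G (length (x # w)) i j"
        using calculation k vs Cons.hyps Cons.prems by (auto simp: paths_Suc)
      ultimately show "A x i k * path_weight A w vs \<le> b" using * by force
    qed
    finally show ?thesis .
  qed
qed

section \<open>Entries of products, and morphisms from the free semigroup\<close>

text \<open>Upper bounds for the entries of \<open>M\<close> and \<open>N\<close> bound all products
  \<open>M i k * N k j\<close>, so the \<open>SUP\<close> in the multiplication is a true least
  upper bound.\<close>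

lemma poset_matrices_mult_le_iff:
  assumes "M \<in> carrier (poset_matrices G r)" "N \<in> carrier (poset_matrices G r)"
    and "i \<in> G" "j \<in> G"
  shows "(M \<otimes>\<^bsub>poset_matrices G r\<^esub> N) i j \<le> b \<longleftrightarrow> (\<forall>k\<in>G. M i k * N k j \<le> b)"
proof -
  have bound: "\<exists>m. \<forall>i\<in>G. \<forall>j\<in>G. A i j \<le> m" if "A \<in> carrier (poset_matrices G r)" for A
  proof -
    have "bdd_above {A i j | i j. i \<in> G \<and> j \<in> G}"
      using that by (simp add: poset_matrices_def)
    then obtain m where "\<forall>x\<in>{A i j | i j. i \<in> G \<and> j \<in> G}. x \<le> m"
      unfolding bdd_above_def ..
    then show ?thesis by blast
  qed
  obtain m where m: "\<forall>i\<in>G. \<forall>j\<in>G. M i j \<le> m"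
    using bound[OF assms(1)] ..
  obtain n where n: "\<forall>i\<in>G. \<forall>j\<in>G. N i j \<le> n"
    using bound[OF assms(2)] ..
  have "bdd_above ((\<lambda>k. M i k * N k j) ` G)"
    using m n assms(3,4) by (intro bdd_aboveI2[of _ _ "m * n"] tropical_mult_mono) blast+
  then show ?thesis by (simp add: poset_matrices_def tropical_Sup_le_iff)
qed

lemma UT_mult_closed:
  assumes "M \<in> carrier (UT n)" "N \<in> carrier (UT n)"
  shows "M * N \<in> carrier (UT n)"
proof -
  have M: "M \<in> carrier_mat n n" "\<And>i j. i < n \<Longrightarrow> j < i \<Longrightarrow> M $$ (i, j) = 0"
    and N: "N \<in> carrier_mat n n" "\<And>i j. i < n \<Longrightarrow> j < i \<Longrightarrow> N $$ (i, j) = 0"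
    using assms by (auto simp: UT_def upper_triangular_def)
  have "(M * N) $$ (i, j) = 0" if "i < n" "j < i" for i j
  proof -
    \<comment> \<open>As \<open>j < i\<close>, either \<open>k < i\<close> or \<open>j < k\<close>,
      so one of the factors lies below the diagonal.\<close>
    have "M $$ (i, k) * N $$ (k, j) = 0" if "k < n" for k
      using M(2)[of i k] N(2)[of k j] \<open>i < n\<close> \<open>j < i\<close> that by (cases "k < i") auto
    then show ?thesis using M(1) N(1) that by (simp add: scalar_prod_def)
  qed
  then show ?thesis using M(1) N(1) by (auto simp: UT_def upper_triangular_def)
qed

lemma UT_mult_le_iff:
  assumes "M \<in> carrier (UT n)" "N \<in> carrier (UT n)" "i < n" "j < n"
  shows "(M * N) $$ (i, j) \<le> b \<longleftrightarrow> (\<forall>k<n. M $$ (i, k) * N $$ (k, j) \<le> b)"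
  using assms by (auto simp: UT_def scalar_prod_def tropical_sum_le_iff)

text \<open>This is the universal property of the free semigroup: matrices may be prescribed freely
  on letters. It supplies the morphism attached to a chain.\<close>

lemma word_product_UT_hom:
  assumes "\<And>x. x \<in> X \<Longrightarrow> B x \<in> carrier (UT n)"
  defines "\<psi> \<equiv> \<lambda>w. foldr (\<lambda>x M. B x * M) w (1\<^sub>m n)"
  shows "\<psi> \<in> hom (free_semigroup X) (UT n)" "x \<in> X \<Longrightarrow> \<psi> [x] = B x"
proof -
  have closed: "\<psi> w \<in> carrier (UT n)" if "w \<in> lists X" for w
    using that
  proof (induction w)
    case Nil
    show ?case by (auto simp: \<psi>_def UT_def)
  next
    case (Cons x w)
    then show ?case using UT_mult_closed[OF assms(1)] by (simp add: \<psi>_def)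
  qed
  have dim: "M \<in> carrier_mat n n" if "M \<in> carrier (UT n)" for M
    using that by (simp add: UT_def)
  have append: "\<psi> (u @ v) = \<psi> u * \<psi> v" if "u \<in> lists X" "v \<in> lists X" for u v
    using that
  proof (induction u)
    case Nil
    then show ?case using dim[OF closed[of v]] by (simp add: \<psi>_def)
  next
    case (Cons x u)
    have "B x * (\<psi> u * \<psi> v) = B x * \<psi> u * \<psi> v"
      using Cons.hyps Cons.prems assms(1) closed dim by (metis assoc_mult_mat)
    then show ?case using Cons by (simp add: \<psi>_def)
  qed
  show "\<psi> \<in> hom (free_semigroup X) (UT n)"
    using closed append by (auto simp: hom_def free_semigroup_def UT_def)
  show "\<psi> [x] = B x" if "x \<in> X"
    using dim[OF assms(1)[OF that]] by (simp add: \<psi>_def)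
qed

lemma hom_free_semigroup_Cons:
  assumes "\<phi> \<in> hom (free_semigroup X) S" "x \<in> X" "w \<in> lists X" "w \<noteq> []"
  shows "\<phi> (x # w) = \<phi> [x] \<otimes>\<^bsub>S\<^esub> \<phi> w"
  using hom_mult[OF assms(1), of "[x]" w] assms(2-) by (simp add: free_semigroup_def)

lemma hom_free_semigroup_closed:
  assumes "\<phi> \<in> hom (free_semigroup X) S" "w \<in> lists X" "w \<noteq> []"
  shows "\<phi> w \<in> carrier S"
  using assms by (auto simp: hom_def free_semigroup_def)

lemma poset_matrices_entry_le_iff:
  assumes "\<phi> \<in> hom (free_semigroup X) (poset_matrices G r)" "w \<in> lists X" "w \<noteq> []" "i \<in> G" "j \<in> G"
  shows "\<phi> w i j \<le> b \<longleftrightarrow>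
    (\<forall>vs\<in>paths G (length w) i j. path_weight (\<lambda>x. \<phi> [x]) w vs \<le> b)"
proof (rule entry_le_iff_path_weights_le[where X = X])
  fix x w i j b assume *: "x \<in> X" "w \<in> lists X" "w \<noteq> []" "i \<in> G" "j \<in> G"
  show "\<phi> (x # w) i j \<le> b \<longleftrightarrow> (\<forall>k\<in>G. \<phi> [x] i k * \<phi> w k j \<le> b)"
    using * hom_free_semigroup_closed[OF assms(1)] hom_free_semigroup_Cons[OF assms(1)]
    by (simp add: poset_matrices_mult_le_iff)
qed (use assms in auto)

lemma UT_entry_le_iff:
  assumes "\<psi> \<in> hom (free_semigroup X) (UT n)" "w \<in> lists X" "w \<noteq> []" "i < n" "j < n"
  shows "\<psi> w $$ (i, j) \<le> b \<longleftrightarrow>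
    (\<forall>vs\<in>paths {..<n} (length w) i j. path_weight (\<lambda>x i j. \<psi> [x] $$ (i, j)) w vs \<le> b)"
proof (rule entry_le_iff_path_weights_le[where X = X and E = "\<lambda>w i j. \<psi> w $$ (i, j)"])
  fix x w i j b assume *: "x \<in> X" "w \<in> lists X" "w \<noteq> []" "i \<in> {..<n}" "j \<in> {..<n}"
  have "\<psi> (x # w) = \<psi> [x] * \<psi> w"
    using hom_free_semigroup_Cons[OF assms(1)] * by (simp add: UT_def)
  then show "\<psi> (x # w) $$ (i, j) \<le> b \<longleftrightarrow> (\<forall>k\<in>{..<n}. \<psi> [x] $$ (i, k) * \<psi> w $$ (k, j) \<le> b)"
    using * hom_free_semigroup_closed[OF assms(1)] by (simp add: UT_mult_le_iff Ball_def)
qed (use assms in auto)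

section \<open>From identities of \<open>UT n\<close> to identities of the poset matrices\<close>

text \<open>\<open>sorted_wrt\<close> relates all pairs and not only neighbours, so it survives the
  deletion of elements.\<close>

lemma sorted_wrt_remdups: "sorted_wrt R xs \<Longrightarrow> sorted_wrt R (remdups xs)"
  by (induction xs) auto

text \<open>Each path for \<open>u\<close> is bounded separately, by a morphism into
  \<open>UT n\<close> built from that path's own vertices. An inequality suffices, as
  \<open>u\<close> and \<open>v\<close> can be exchanged.\<close>

lemma poset_matrices_entry_mono_if_UT_identity:
  assumes po: "partial_order_on G r" and chains: "max_chain_length G r n"
    and u: "u \<in> lists X" "u \<noteq> []" and v: "v \<in> lists X" "v \<noteq> []"
    and UT: "satisfies_identity (UT n) X u v"
    and \<phi>: "\<phi> \<in> hom (free_semigroup X) (poset_matrices G r)"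
    and ij: "i \<in> G" "j \<in> G"
  shows "\<phi> u i j \<le> \<phi> v i j"
proof (subst poset_matrices_entry_le_iff[OF \<phi> u ij], intro ballI)
  let ?A = "\<lambda>x. \<phi> [x]"
  fix vs assume vs: "vs \<in> paths G (length u) i j"
  have trans: "trans r" and antisym: "antisym r"
    using po by (auto simp: partial_order_on_def preorder_on_def)
  have support: "(a, b) \<in> r" if "x \<in> X" "?A x a b \<noteq> 0" for x a b
    using hom_free_semigroup_closed[OF \<phi>, of "[x]"] that by (auto simp: poset_matrices_def)
  show "path_weight ?A u vs \<le> \<phi> v i j"
  proof (cases "path_weight ?A u vs = 0")
    case True
    then show ?thesis by simp
  next
    case False
    \<comment> \<open>Reflexivity lets a path stay at a vertex, so repetitions are removed to obtain
      a chain.\<close>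
    define cs where "cs = remdups vs"
    have cs: "distinct cs" "set cs = set vs" by (simp_all add: cs_def)
    have "successively (\<lambda>a b. (a, b) \<in> r) vs"
      by (rule successively_if_path_weight_nonzero[OF False])
        (use vs support u in \<open>auto simp: paths_def\<close>)
    moreover have "transp (\<lambda>a b. (a, b) \<in> r)"
      using trans by (simp add: transp_trans_eq)
    ultimately have sorted: "sorted_wrt (\<lambda>a b. (a, b) \<in> r) cs"
      unfolding cs_def by (simp add: successively_conv_sorted_wrt sorted_wrt_remdups)
    then have "successively (\<lambda>a b. (a, b) \<in> r) cs"
      by (rule successively_if_sorted_wrt)
    moreover have "set cs \<subseteq> G" using vs cs by (simp add: paths_def)
    ultimately have len: "length cs \<le> n"
      using chains cs unfolding max_chain_length_def by blast
    \<comment> \<open>The matrices are restricted to the chain and padded with \<open>0\<close> up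
      to size \<open>n\<close>, since the chain may be shorter.\<close>
    define B where "B = (\<lambda>x. mat n n (\<lambda>(s, t).
      if s < length cs \<and> t < length cs then ?A x (cs ! s) (cs ! t) else 0))"
    have "B x \<in> carrier (UT n)" if "x \<in> X" for x
    proof -
      \<comment> \<open>A nonzero entry below the diagonal would contradict antisymmetry for two
        distinct elements of the chain.\<close>
      have "?A x (cs ! s) (cs ! t) = 0" if "s < length cs" "t < s" for s t
      proof (rule ccontr)
        assume "?A x (cs ! s) (cs ! t) \<noteq> 0"
        then have "(cs ! s, cs ! t) \<in> r" using support \<open>x \<in> X\<close> by blast
        moreover have "(cs ! t, cs ! s) \<in> r"
          using sorted that by (simp add: sorted_wrt_iff_nth_less)
        ultimately have "cs ! s = cs ! t" using antisym by (simp add: antisym_def)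
        then show False using cs(1) that by (simp add: nth_eq_iff_index_eq)
      qed
      then show ?thesis by (auto simp: B_def UT_def upper_triangular_def)
    qed
    then obtain \<psi> where \<psi>: "\<psi> \<in> hom (free_semigroup X) (UT n)" and \<psi>B: "\<And>x. x \<in> X \<Longrightarrow> \<psi> [x] = B x"
      using word_product_UT_hom[of X B n] by blast
    let ?B = "\<lambda>x s t. \<psi> [x] $$ (s, t)"
    \<comment> \<open>Padding positions go to \<open>i\<close>, just to stay in \<open>G\<close>;
      the entries of \<open>B x\<close> there are \<open>0\<close>, so \<open>B_le\<close> still
      holds.\<close>
    define f where "f = (\<lambda>s. if s < length cs then cs ! s else i)"
    have f: "f s \<in> G" for s using cs vs ij by (auto simp: f_def paths_def dest: nth_mem)
    have B_le: "?B x s t \<le> ?A x (f s) (f t)" if "x \<in> X" "s < n" "t < n" for x s t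
      using that by (simp add: \<psi>B B_def f_def)
    have "\<forall>a\<in>set vs. \<exists>s<length cs. a = cs ! s"
      using cs(2) by (metis in_set_conv_nth)
    then obtain g where g: "\<And>a. a \<in> set vs \<Longrightarrow> g a < length cs \<and> cs ! g a = a"
      by metis
    have vs_ne: "vs \<noteq> []" "hd vs = i" "last vs = j" "length vs = Suc (length u)"
      using vs by (auto simp: paths_def)
    then have gi: "g i < n" "f (g i) = i" and gj: "g j < n" "f (g j) = j"
      using g[of i] g[of j] len by (auto simp: f_def)
    \<comment> \<open>Restriction keeps every entry that \<open>vs\<close> meets. The trivial
      \<open>map\<close> only gives the left side the form of
      \<open>path_weight_mono\<close>.\<close>
    have "path_weight ?A u (map (\<lambda>a. a) vs) \<le> path_weight ?B u (map g vs)"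
    proof (rule path_weight_mono)
      fix x a b assume "x \<in> set u" "a \<in> set vs" "b \<in> set vs"
      then show "?A x a b \<le> ?B x (g a) (g b)"
        using g[of a] g[of b] len u by (auto simp: \<psi>B B_def)
    qed
    also have "\<dots> \<le> \<psi> u $$ (g i, g j)"
    proof -
      have "map g vs \<in> paths {..<n} (length u) (g i) (g j)"
        using g len vs_ne by (force simp: paths_def hd_map last_map)
      then show ?thesis using UT_entry_le_iff[OF \<psi> u gi(1) gj(1)] by blast
    qed
    also have "\<psi> u = \<psi> v"
      using UT \<psi> by (simp add: satisfies_identity_def)
    \<comment> \<open>Conversely, \<open>f\<close> turns each path of positions for \<open>v\<close>
      into a path in \<open>G\<close> of at least the same weight.\<close>
    also have "\<psi> v $$ (g i, g j) \<le> \<phi> v i j"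
    proof (subst UT_entry_le_iff[OF \<psi> v gi(1) gj(1)], intro ballI)
      fix ss assume ss: "ss \<in> paths {..<n} (length v) (g i) (g j)"
      then have "ss \<noteq> []" by (auto simp: paths_def)
      then have "map f ss \<in> paths G (length v) i j"
        using ss f gi gj by (auto simp: paths_def hd_map last_map)
      then have "path_weight ?A v (map f ss) \<le> \<phi> v i j"
        using poset_matrices_entry_le_iff[OF \<phi> v ij] by blast
      moreover have "path_weight ?B v (map (\<lambda>s. s) ss) \<le> path_weight ?A v (map f ss)"
        by (rule path_weight_mono) (use B_le ss v in \<open>simp add: paths_def in_lists_conv_set subset_eq\<close>)
      ultimately show "path_weight ?B v ss \<le> \<phi> v i j" by simp
    qed
    finally show ?thesis by simp
  qed
qed

section \<open>From identities of the poset matrices to identities of \<open>UT n\<close>\<close>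

text \<open>Positions in the chain \<open>cs\<close> serve as matrix indices, and matrices are
  extended by \<open>0\<close> off the chain; elements off the chain then contribute nothing to a
  product.\<close>

lemma UT_embeds_into_poset_matrices:
  assumes cs: "length cs = n" "distinct cs" "set cs \<subseteq> G" and sorted: "sorted_wrt (\<lambda>a b. (a, b) \<in> r) cs"
    and refl: "refl_on G r"
  obtains \<iota> where "\<iota> \<in> hom (UT n) (poset_matrices G r)" "inj_on \<iota> (carrier (UT n))"
proof -
  have "inj_on ((!) cs) {..<n}" using cs by (simp add: inj_on_nth)
  then obtain g where g: "\<And>s. s < n \<Longrightarrow> g (cs ! s) = s"
    using the_inv_into_f_f by (metis lessThan_iff)
  define \<iota> :: "tropical mat \<Rightarrow> 'a \<Rightarrow> 'a \<Rightarrow> tropical"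
    where "\<iota> M a b = (if a \<in> set cs \<and> b \<in> set cs then M $$ (g a, g b) else 0)" for M a b
  have \<iota>_nth: "\<iota> M (cs ! s) (cs ! t) = M $$ (s, t)" if "s < n" "t < n" for M s t
    using g cs(1) that by (simp add: \<iota>_def)
  have \<iota>_cases: "(\<exists>s<n. \<exists>t<n. a = cs ! s \<and> b = cs ! t) \<or> (a \<notin> set cs \<or> b \<notin> set cs)" for a b
    using cs(1) by (metis in_set_conv_nth)
  have closed: "\<iota> M \<in> carrier (poset_matrices G r)" if "M \<in> carrier (UT n)" for M
  proof -
    \<comment> \<open>The image has only finitely many distinct entries, hence is bounded even for
      infinite \<open>G\<close>.\<close>
    have "{\<iota> M a b | a b. a \<in> G \<and> b \<in> G} \<subseteq> insert 0 ((\<lambda>(s, t). M $$ (s, t)) ` ({..<n} \<times> {..<n}))"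
    proof -
      have "\<iota> M a b \<in> insert 0 ((\<lambda>(s, t). M $$ (s, t)) ` ({..<n} \<times> {..<n}))" for a b
      proof (cases "a \<in> set cs \<and> b \<in> set cs")
        case True
        then obtain s t where "s < n" "t < n" "a = cs ! s" "b = cs ! t"
          using \<iota>_cases[of a b] by blast
        then show ?thesis by (intro insertI2 image_eqI[of _ _ "(s, t)"]) (simp_all add: \<iota>_nth)
      qed (auto simp: \<iota>_def)
      then show ?thesis by blast
    qed
    then have "bdd_above {\<iota> M a b | a b. a \<in> G \<and> b \<in> G}"
      by (rule bdd_above_mono[rotated]) (simp add: bdd_above_finite)
    moreover have "(a, b) \<in> r" if nonzero: "\<iota> M a b \<noteq> 0" for a b
    proof -
      obtain s t where st: "s < n" "t < n" "a = cs ! s" "b = cs ! t"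
        using \<iota>_cases[of a b] nonzero by (auto simp: \<iota>_def)
      then have "M $$ (s, t) \<noteq> 0" using nonzero by (simp add: \<iota>_nth)
      then have "\<not> t < s" using \<open>M \<in> carrier (UT n)\<close> st
        by (auto simp: UT_def upper_triangular_def)
      \<comment> \<open>Diagonal entries use reflexivity, entries above the diagonal use the order
        of the chain.\<close>
      then show ?thesis
        using st sorted cs refl by (cases "s = t") (auto simp: sorted_wrt_iff_nth_less refl_on_def subset_eq)
    qed
    ultimately show ?thesis by (simp add: poset_matrices_def)
  qed
  have "\<iota> (M * N) = \<iota> M \<otimes>\<^bsub>poset_matrices G r\<^esub> \<iota> N"
    if MN: "M \<in> carrier (UT n)" "N \<in> carrier (UT n)" for M N
  proof (intro ext)
    fix a b
    show "\<iota> (M * N) a b = (\<iota> M \<otimes>\<^bsub>poset_matrices G r\<^esub> \<iota> N) a b"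
    proof (cases "a \<in> set cs \<and> b \<in> set cs")
      case False
      then have "\<iota> M a k * \<iota> N k b = 0" for k by (auto simp: \<iota>_def)
      then have "(\<iota> M \<otimes>\<^bsub>poset_matrices G r\<^esub> \<iota> N) a b = 0"
        by (cases "G = {}") (simp_all add: poset_matrices_def Sup_tropical_empty)
      then show ?thesis using False by (auto simp: \<iota>_def)
    next
      case True
      then obtain s t where st: "s < n" "t < n" "a = cs ! s" "b = cs ! t"
        using \<iota>_cases[of a b] by auto
      \<comment> \<open>A finite sum and a supremum over \<open>G\<close> are identified by having
        the same upper bounds.\<close>
      have "\<iota> (M * N) a b \<le> c \<longleftrightarrow> (\<iota> M \<otimes>\<^bsub>poset_matrices G r\<^esub> \<iota> N) a b \<le> c" for c
      proof -
        have "\<iota> (M * N) a b \<le> c \<longleftrightarrow> (\<forall>k<n. M $$ (s, k) * N $$ (k, t) \<le> c)"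
          using st UT_mult_le_iff[OF MN st(1,2)] by (simp add: \<iota>_nth)
        also have "\<dots> \<longleftrightarrow> (\<forall>k<n. \<iota> M a (cs ! k) * \<iota> N (cs ! k) b \<le> c)"
          using st by (simp add: \<iota>_nth)
        also have "\<dots> \<longleftrightarrow> (\<forall>k\<in>set cs. \<iota> M a k * \<iota> N k b \<le> c)"
          using cs(1) by (simp add: all_set_conv_all_nth)
        also have "\<dots> \<longleftrightarrow> (\<forall>k\<in>G. \<iota> M a k * \<iota> N k b \<le> c)"
        proof -
          have "\<iota> M a k * \<iota> N k b \<le> c" if "k \<notin> set cs" for k
            using that by (simp add: \<iota>_def)
          then show ?thesis using cs(3) by blast
        qed
        also have "\<dots> \<longleftrightarrow> (\<iota> M \<otimes>\<^bsub>poset_matrices G r\<^esub> \<iota> N) a b \<le> c"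
          using True cs(3) by (subst poset_matrices_mult_le_iff[OF closed[OF MN(1)] closed[OF MN(2)]]) auto
        finally show ?thesis .
      qed
      then show ?thesis by (meson antisym order_refl)
    qed
  qed
  then have hom: "\<iota> \<in> hom (UT n) (poset_matrices G r)"
    using closed by (auto simp: hom_def UT_def)
  have "inj_on \<iota> (carrier (UT n))"
  proof (rule inj_onI)
    fix M N assume MN: "M \<in> carrier (UT n)" "N \<in> carrier (UT n)" "\<iota> M = \<iota> N"
    have "M $$ (s, t) = N $$ (s, t)" if "s < n" "t < n" for s t
      using \<iota>_nth[OF that] MN(3) by metis
    then show "M = N" using MN by (intro eq_matI) (auto simp: UT_def)
  qed
  then show ?thesis using that hom by blast
qed

theorem theorem5p3:
  fixes G :: "'a set" and r :: "'a rel" and n :: nat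
  assumes "partial_order_on G r"
    and "max_chain_length G r n"
  shows "\<forall>X :: 'x set. finite X \<longrightarrow>
    (\<forall>u \<in> carrier (free_semigroup X). \<forall>v \<in> carrier (free_semigroup X).
      satisfies_identity (poset_matrices G r) X u v \<longleftrightarrow> satisfies_identity (UT n) X u v)"
proof (intro allI impI ballI iffI)
  fix X :: "'x set" and u v
  assume "u \<in> carrier (free_semigroup X)" "v \<in> carrier (free_semigroup X)"
  then have u: "u \<in> lists X" "u \<noteq> []" and v: "v \<in> lists X" "v \<noteq> []"
    by (auto simp: free_semigroup_def)
  have r: "refl_on G r" "trans r" "r \<subseteq> G \<times> G"
    using assms(1) by (auto simp: partial_order_on_def preorder_on_def)
  {
    assume poset: "satisfies_identity (poset_matrices G r) X u v"
    \<comment> \<open>The characterisation of chain lengths, taken at \<open>k = n\<close>, gives a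
      chain with exactly \<open>n\<close> elements.\<close>
    obtain cs where cs: "length cs = n" "distinct cs" "set cs \<subseteq> G"
      and "successively (\<lambda>a b. (a, b) \<in> r) cs"
      using assms(2) unfolding max_chain_length_def by blast
    then have "sorted_wrt (\<lambda>a b. (a, b) \<in> r) cs"
      using r(2) successively_conv_sorted_wrt[of "\<lambda>a b. (a, b) \<in> r" cs]
      by (simp add: transp_trans_eq)
    then obtain \<iota> where \<iota>: "\<iota> \<in> hom (UT n) (poset_matrices G r)" "inj_on \<iota> (carrier (UT n))"
      using UT_embeds_into_poset_matrices[OF cs _ r(1)] by blast
    show "satisfies_identity (UT n) X u v"
      unfolding satisfies_identity_def
    proof
      fix \<psi> assume \<psi>: "\<psi> \<in> hom (free_semigroup X) (UT n)"
      then have "\<iota> \<circ> \<psi> \<in> hom (free_semigroup X) (poset_matrices G r)"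
        using \<iota>(1) by (rule hom_compose)
      then have "\<iota> (\<psi> u) = \<iota> (\<psi> v)"
        using poset by (auto simp: satisfies_identity_def)
      then show "\<psi> u = \<psi> v"
        using \<iota>(2) \<psi> u v by (meson hom_free_semigroup_closed inj_onD)
    qed
  next
    assume UT: "satisfies_identity (UT n) X u v"
    then have UT': "satisfies_identity (UT n) X v u"
      unfolding satisfies_identity_def by metis
    show "satisfies_identity (poset_matrices G r) X u v"
      unfolding satisfies_identity_def
    proof (intro ballI ext)
      fix \<phi> i j assume \<phi>: "\<phi> \<in> hom (free_semigroup X) (poset_matrices G r)"
      show "\<phi> u i j = \<phi> v i j"
      proof (cases "i \<in> G \<and> j \<in> G")
        case True
        then show ?thesis
          using poset_matrices_entry_mono_if_UT_identity[OF assms u v UT \<phi>]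
            poset_matrices_entry_mono_if_UT_identity[OF assms v u UT' \<phi>]
          by (simp add: antisym)
      next
        case False
        \<comment> \<open>Outside \<open>G\<close> both entries are \<open>0\<close> by the support
          condition, as \<open>r\<close> relates only elements of \<open>G\<close>.\<close>
        have "\<phi> w i j = 0" if "w \<in> lists X" "w \<noteq> []" for w
          using hom_free_semigroup_closed[OF \<phi> that] False r(3)
          by (auto simp: poset_matrices_def)
        then show ?thesis using u v by simp
      qed
    qed
  }
qed

end
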